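(* Let $$W:=\{(p,q)\in\mathbb{N}^2: \text{both } ord_2(p) \text{ and } ord_2(q)\text{ are even},\ p<q,\ p\text{ and }q\text{ are coprime}\},$$ $$\hat W:=\{(p,q)\in\mathbb{N}^2: ord_2(p)\text{ is odd or } ord_2(q)\text{ is odd},\ p<q,\ p\text{ and }q\text{ are coprime}\}.$$ Then $$\lim_{N\to\infty}\frac{\#(W\cap[1, N]^2)}{N^2}=\frac{5}{3\pi^2}\quad\text{and}\quad \lim_{N\to\infty}\frac{\#(\hat W\cap[1, N]^2)}{N^2}=\frac{4}{3\pi^2}.$$
   Context: $\mathbb{N}=\{1,2,\dots\}$. For $n\in\mathbb N$, $ord_2(n)$ is the largest integer $j\ge0$ such that $2^j$ divides $n$ (so $0$ counts as even). $\#A$ is the cardinality of $A$. *)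

theory Defs
  imports Complex_Main "HOL-Computational_Algebra.Primes"
begin

(* The index set {1, 2, ...} is rendered by explicit positivity constraints. On positive
   arguments, multiplicity 2 n is the largest j with 2 ^ j dvd n. *)

definition W :: "(nat \<times> nat) set" where
  "W = {(p, q). 1 \<le> p \<and> 1 \<le> q \<and> even (multiplicity 2 p) \<and> even (multiplicity 2 q)
                \<and> p < q \<and> coprime p q}"

definition W_hat :: "(nat \<times> nat) set" where
  "W_hat = {(p, q). 1 \<le> p \<and> 1 \<le> q \<and> (odd (multiplicity 2 p) \<or> odd (multiplicity 2 q))
                    \<and> p < q \<and> coprime p q}"

end

theory Submission
  imports Defs "HOL-Analysis.Analysis"
begin

text \<open>
  Let \<open>D\<close> be a multiplicative set of positive integers that is closed under gcds and quotients,
  and let \<open>C(N)\<close> count the coprime pairs in \<open>D \<inter> {1..N}\<close>. Grouping all pairs by their gcd gives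
  \<open>#(D \<inter> {1..N})\<^sup>2 = (\<Sum>d\<in>D. C(N div d))\<close>. If \<open>D\<close> has density \<open>\<delta>\<close> and
  \<open>S = (\<Sum>d\<in>D. 1 / d\<^sup>2) < 2\<close>, then solving this identity for the term \<open>d = 1\<close> is a contraction
  of ratio \<open>S - 1\<close> on the error \<open>C(N) - (\<delta>\<^sup>2 / S) N\<^sup>2\<close>, which is therefore \<open>o(N\<^sup>2)\<close>; no
  Moebius inversion is needed. The set of \<open>n\<close> with \<open>ord\<^sub>2 n\<close> even has density \<open>2 / 3\<close> and
  \<open>S = (4 / 5) (\<pi>\<^sup>2 / 6)\<close>, because a positive integer lies either in it or in its double; the
  set of all positive integers has density \<open>1\<close> and \<open>S = \<pi>\<^sup>2 / 6\<close>.
\<close>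

section \<open>Errors of lower order\<close>

text \<open>The finitely many \<open>n\<close> up to the threshold are absorbed into
  \<open>C\<close>, so the bound holds at every \<open>n\<close>. This is the form of o(n^2) that
  the recursion can use, since \<open>n div d\<close> also takes small values.\<close>

lemma tendsto_div_square_zeroD:
  fixes f :: "nat \<Rightarrow> real"
  assumes "(\<lambda>n. f n / (real n)\<^sup>2) \<longlonglongrightarrow> 0" "e > 0"
  shows "\<exists>C\<ge>0. \<forall>n. \<bar>f n\<bar> \<le> e * (real n)\<^sup>2 + C"
proof -
  obtain n0 where n0: "\<And>n. n \<ge> n0 \<Longrightarrow> \<bar>f n / (real n)\<^sup>2\<bar> < e"
    using LIMSEQ_D[OF assms] by auto
  define C where "C = (\<Sum>n\<le>n0. \<bar>f n\<bar>)"
  have "\<bar>f n\<bar> \<le> e * (real n)\<^sup>2 + C" for n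
  proof (cases "n \<le> n0")
    case True
    then have "\<bar>f n\<bar> \<le> C"
      unfolding C_def by (intro member_le_sum) auto
    then show ?thesis using assms(2) by (simp add: add_increasing)
  next
    case False
    then have "\<bar>f n\<bar> \<le> e * (real n)\<^sup>2"
      using n0[of n] by (auto simp: abs_divide field_simps)
    moreover have "C \<ge> 0" by (simp add: C_def sum_nonneg)
    ultimately show ?thesis by simp
  qed
  moreover have "C \<ge> 0" by (simp add: C_def sum_nonneg)
  ultimately show ?thesis by blast
qed

text \<open>Half of \<open>r\<close> goes to the main term, and the other half beats
  \<open>C\<close> once \<open>real n ^ k\<close> exceeds \<open>2 * \<bar>C\<bar> / r\<close>. The
  exponent is left open because pairs use \<open>k = 2\<close> and single integers use
  \<open>k = 1\<close>.\<close>

lemma tendsto_div_power_zeroI: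
  fixes f :: "nat \<Rightarrow> real"
  assumes bound: "\<And>e. e > 0 \<Longrightarrow> \<exists>C. \<forall>n. \<bar>f n\<bar> \<le> e * real n ^ k + C" and k: "k > 0"
  shows "(\<lambda>n. f n / real n ^ k) \<longlonglongrightarrow> 0"
proof (rule LIMSEQ_I)
  fix r :: real assume r: "r > 0"
  then obtain C where C: "\<And>n. \<bar>f n\<bar> \<le> r / 2 * real n ^ k + C"
    using bound[of "r / 2"] by auto
  obtain m :: nat where m: "2 * \<bar>C\<bar> / r < real m"
    using reals_Archimedean2 by blast
  have "norm (f n / real n ^ k - 0) < r" if n: "n \<ge> Suc m" for n
  proof -
    have "real m < real n ^ k"
      using n k self_le_power[of "real n" k] by linarith
    with m have "2 * \<bar>C\<bar> / r < real n ^ k" by (rule less_trans)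
    then have "\<bar>C\<bar> < r / 2 * real n ^ k"
      using r by (simp add: pos_divide_less_eq mult.commute)
    then have "\<bar>f n\<bar> < r * real n ^ k"
      using C[of n] by linarith
    then show ?thesis using n by (simp add: abs_divide field_simps)
  qed
  then show "\<exists>no. \<forall>n\<ge>no. norm (f n / real n ^ k - 0) < r" by blast
qed

lemma real_div_le_mono_square:
  "(real (n div d))\<^sup>2 \<le> (real n)\<^sup>2 * (1 / (real d)\<^sup>2)"
proof -
  have "(real (n div d))\<^sup>2 \<le> (real n / real d)\<^sup>2"
    by (intro power_mono of_nat_div_le_of_nat) auto
  then show ?thesis by (simp add: power_divide)
qed

text \<open>Let \<open>I\<close> be the infimum of all \<open>K \<ge> 0\<close> with
  \<open>\<bar>F n\<bar> \<le> K * (real n)\<^sup>2 + O(1)\<close>. Feeding such a bound into the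
  recursion replaces \<open>K\<close> by \<open>s * K\<close> plus an arbitrarily small amount, so
  \<open>I \<le> s * I\<close>, and \<open>s < 1\<close> forces \<open>I = 0\<close>.\<close>

lemma contraction_little_o:
  fixes F :: "nat \<Rightarrow> real"
  assumes F: "\<And>n. \<bar>F n\<bar> \<le> K0 * (real n)\<^sup>2"
    and rec: "\<And>e. e > 0 \<Longrightarrow> \<exists>C\<ge>0. \<forall>n. \<bar>F n\<bar> \<le> e * (real n)\<^sup>2 + C + (\<Sum>d\<in>D \<inter> {2..n}. \<bar>F (n div d)\<bar>)"
    and s: "\<And>n. (\<Sum>d\<in>D \<inter> {2..n}. 1 / (real d)\<^sup>2) \<le> s" "s < 1"
  shows "(\<lambda>n. F n / (real n)\<^sup>2) \<longlonglongrightarrow> 0"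
proof -
  have s0: "s \<ge> 0" using s(1)[of 0] by simp
  define X where "X = {K. K \<ge> 0 \<and> (\<exists>C\<ge>0. \<forall>n. \<bar>F n\<bar> \<le> K * (real n)\<^sup>2 + C)}"
  \<comment> \<open>One \<open>e\<close> comes from \<open>rec\<close>; the other pays for the
    constants \<open>C\<close> summed over at most \<open>n\<close> values of
    \<open>d\<close>.\<close>
  have step: "s * K + 2 * e \<in> X" if K: "K \<in> X" and e: "e > 0" for K e
  proof -
    obtain C where C: "C \<ge> 0" "\<And>n. \<bar>F n\<bar> \<le> K * (real n)\<^sup>2 + C" and K0: "K \<ge> 0"
      using K by (auto simp: X_def)
    obtain C' where C': "C' \<ge> 0"
      "\<And>n. \<bar>F n\<bar> \<le> e * (real n)\<^sup>2 + C' + (\<Sum>d\<in>D \<inter> {2..n}. \<bar>F (n div d)\<bar>)"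
      using rec[OF e] by blast
    have "\<bar>F n\<bar> \<le> (s * K + 2 * e) * (real n)\<^sup>2 + (C' + C\<^sup>2 / e)" for n
    proof -
      have "(\<Sum>d\<in>D \<inter> {2..n}. \<bar>F (n div d)\<bar>)
          \<le> (\<Sum>d\<in>D \<inter> {2..n}. K * ((real n)\<^sup>2 * (1 / (real d)\<^sup>2)) + C)"
        by (intro sum_mono order_trans[OF C(2)] add_right_mono mult_left_mono
              real_div_le_mono_square K0)
      also have "\<dots> = K * (real n)\<^sup>2 * (\<Sum>d\<in>D \<inter> {2..n}. 1 / (real d)\<^sup>2) + real (card (D \<inter> {2..n})) * C"
        by (simp add: sum.distrib sum_distrib_left mult.assoc)
      also have "\<dots> \<le> K * (real n)\<^sup>2 * s + real n * C"
      proof (intro add_mono mult_left_mono mult_right_mono s(1) C(1))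
        have "card (D \<inter> {2..n}) \<le> card {1..n}" by (intro card_mono) auto
        then show "real (card (D \<inter> {2..n})) \<le> real n" by simp
      qed (use K0 in auto)
      also have "real n * C \<le> e * (real n)\<^sup>2 + C\<^sup>2 / e"
      proof -
        \<comment> \<open>The linear term is split between the quadratic one and a constant by
          expanding this square and dividing by \<open>e\<close>.\<close>
        have "0 \<le> (e * real n - C)\<^sup>2 + e * real n * C" using e C(1) by simp
        then have "e * (real n * C) \<le> e * (e * (real n)\<^sup>2 + C\<^sup>2 / e)"
          using e by (simp add: power2_eq_square algebra_simps)
        then show ?thesis using e by simp
      qed
      finally show ?thesis using C'(2)[of n] by (simp add: algebra_simps)
    qed
    then show ?thesis
      unfolding X_def mem_Collect_eq using s0 K0 e C'(1)
      by (intro conjI exI[of _ "C' + C\<^sup>2 / e"] allI) auto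
  qed
  have "\<bar>F n\<bar> \<le> max K0 0 * (real n)\<^sup>2 + 0" for n
    using F[of n] by (smt (verit) max.cobounded1 mult_right_mono zero_le_power2)
  then have X0: "max K0 0 \<in> X"
    unfolding X_def mem_Collect_eq by (intro conjI exI[of _ 0]) auto
  have bdd: "bdd_below X" by (auto simp: X_def intro: bdd_belowI[of _ 0])
  define I where "I = Inf X"
  have I0: "I \<ge> 0" unfolding I_def
  proof (rule cInf_greatest)
    show "X \<noteq> {}" using X0 by blast
  qed (simp add: X_def)
  have "I \<le> 0"
  proof (rule ccontr)
    assume "\<not> I \<le> 0"
    then have I: "I > 0" by simp
    \<comment> \<open>With this choice \<open>3 * h\<close> is only half of
      \<open>(1 - s) * I\<close>, which contradicts the bound \<open>(1 - s) * I \<le> 3 * h\<close>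
      obtained below.\<close>
    define h where "h = (1 - s) * I / 6"
    have h: "h > 0" using s(2) I by (simp add: h_def)
    obtain K where K: "K \<in> X" "K < I + h"
      using cInf_lessD[of X "I + h"] X0 h unfolding I_def by fastforce
    have "I \<le> s * K + 2 * h"
      unfolding I_def by (intro cInf_lower step K bdd h)
    also have "s * K \<le> s * I + h"
    proof -
      have "s * K \<le> s * (I + h)" using K(2) s0 by (intro mult_left_mono) auto
      moreover have "s * h \<le> 1 * h" using s(2) h by (intro mult_right_mono) auto
      ultimately show ?thesis by (simp add: ring_distribs)
    qed
    finally have "(1 - s) * I \<le> 3 * h" by (simp add: algebra_simps)
    then show False using h unfolding h_def by linarith
  qed
  with I0 have I: "Inf X = 0" by (simp add: I_def)
  show ?thesis
  proof (rule tendsto_div_power_zeroI)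
    fix e :: real assume e: "e > 0"
    then obtain K where K: "K \<in> X" "K < e"
      using cInf_lessD[of X e] X0 I by fastforce
    then obtain C where "\<And>n. \<bar>F n\<bar> \<le> K * (real n)\<^sup>2 + C" by (auto simp: X_def)
    moreover have "K * (real n)\<^sup>2 \<le> e * (real n)\<^sup>2" for n
      using K(2) by (intro mult_right_mono) auto
    ultimately show "\<exists>C. \<forall>n. \<bar>F n\<bar> \<le> e * (real n)\<^sup>2 + C"
      by (meson add_right_mono order_trans)
  qed simp
qed

section \<open>Coprime pairs in a multiplicative set\<close>

text \<open>Ordered pairs, diagonal included, so that grouping by gcd fills the whole square; the
  condition \<open>p < q\<close> is imposed later by symmetry.\<close>

definition coprime_pairs :: "nat set \<Rightarrow> nat \<Rightarrow> (nat \<times> nat) set" where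
  "coprime_pairs D N = {(p, q). p \<in> D \<and> q \<in> D \<and> p \<le> N \<and> q \<le> N \<and> coprime p q}"

lemma coprime_pairs_subset: "coprime_pairs D N \<subseteq> (D \<inter> {..N}) \<times> (D \<inter> {..N})"
  by (auto simp: coprime_pairs_def)

lemma finite_coprime_pairs [simp]: "finite (coprime_pairs D N)"
  by (rule finite_subset[OF coprime_pairs_subset]) auto

text \<open>The closure conditions make \<open>(p, q) = (d * a, d * b)\<close> with
  \<open>d = gcd p q\<close> a correspondence inside \<open>D\<close>: \<open>gcd\<close> and
  \<open>cancel\<close> serve to split a pair, \<open>mult\<close> to rebuild it.\<close>

locale gcd_closed_monoid =
  fixes D :: "nat set"
  assumes zero: "0 \<notin> D" and one: "1 \<in> D"
    and mult: "\<And>a b. a \<in> D \<Longrightarrow> b \<in> D \<Longrightarrow> a * b \<in> D"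
    and cancel: "\<And>a b. a * b \<in> D \<Longrightarrow> a \<in> D \<Longrightarrow> b \<in> D"
    and gcd: "\<And>a b. a \<in> D \<Longrightarrow> b \<in> D \<Longrightarrow> gcd a b \<in> D"
begin

lemma pos: "d \<in> D \<Longrightarrow> d > 0"
  using zero by (cases d) auto

lemma Int_atMost: "D \<inter> {..N} = D \<inter> {1..N}"
  using pos by (auto simp: Suc_le_eq)

text \<open>The map \<open>(d, a, b) \<mapsto> (d * a, d * b)\<close> is a bijection: for coprime
  \<open>a\<close>, \<open>b\<close> the factor \<open>d\<close> is recovered as the gcd, and
  \<open>d * a \<le> N\<close> means \<open>a \<le> N div d\<close>.\<close>

lemma card_square_eq_sum_coprime_pairs:
  "(card (D \<inter> {1..N}))\<^sup>2 = (\<Sum>d\<in>D \<inter> {1..N}. card (coprime_pairs D (N div d)))"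
proof -
  let ?f = "\<lambda>(d, a, b). (d * a, d * b) :: nat \<times> nat"
  let ?A = "SIGMA d:D \<inter> {1..N}. coprime_pairs D (N div d)"
  have inj: "inj_on ?f ?A"
  proof (rule inj_onI, clarsimp simp: coprime_pairs_def)
    fix d a b d' a' b' :: nat
    assume *: "d \<in> D" "d' \<in> D" "coprime a b" "coprime a' b'"
      "d * a = d' * a'" "d * b = d' * b'"
    have "d = gcd (d * a) (d * b)" using *(3) by (simp add: gcd_mult_left)
    also have "\<dots> = gcd (d' * a') (d' * b')" by (simp only: *)
    also have "\<dots> = d'" using *(4) by (simp add: gcd_mult_left)
    finally show "d = d' \<and> a = a' \<and> b = b'" using * pos by auto
  qed
  have "?f ` ?A = (D \<inter> {1..N}) \<times> (D \<inter> {1..N})"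
  proof (intro equalityI subsetI)
    fix x assume "x \<in> ?f ` ?A"
    then obtain d a b where x: "x = (d * a, d * b)" and d: "d \<in> D" "a \<in> D" "b \<in> D"
      and le: "a \<le> N div d" "b \<le> N div d"
      by (auto simp: coprime_pairs_def)
    have "d * a \<le> N" "d * b \<le> N"
      using le pos[OF d(1)] by (simp_all add: less_eq_div_iff_mult_less_eq mult.commute)
    then show "x \<in> (D \<inter> {1..N}) \<times> (D \<inter> {1..N})"
      using x d pos mult by (auto simp: Suc_le_eq)
  next
    fix x assume "x \<in> (D \<inter> {1..N}) \<times> (D \<inter> {1..N})"
    then obtain p q where x: "x = (p, q)" and pq: "p \<in> D" "q \<in> D" "p \<le> N" "q \<le> N" by auto
    define d where "d = gcd p q"
    have d: "d \<in> D" "d > 0" using gcd pq pos by (auto simp: d_def)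
    obtain a b where ab: "p = d * a" "q = d * b" by (metis d_def dvdE gcd_dvd1 gcd_dvd2)
    have "gcd p q = d * gcd a b" by (simp only: ab gcd_mult_distrib_nat)
    then have "d * gcd a b = d * 1" by (simp only: d_def mult_1_right)
    then have "coprime a b"
      using d(2) unfolding mult_cancel1 by (simp add: coprime_iff_gcd_eq_1)
    moreover have "a \<in> D" "b \<in> D" using cancel[of d] ab pq(1,2) d(1) by blast+
    moreover have "a \<le> N div d" "b \<le> N div d"
      using pq ab d(2) by (simp_all add: less_eq_div_iff_mult_less_eq mult.commute)
    moreover have "d \<le> N"
      using pq(3) dvd_imp_le[OF gcd_dvd1 pos[OF pq(1)], of q] by (simp only: d_def)
    ultimately have "(d, a, b) \<in> ?A" using d by (auto simp: coprime_pairs_def)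
    then show "x \<in> ?f ` ?A" unfolding x ab by force
  qed
  then have "card ?A = card ((D \<inter> {1..N}) \<times> (D \<inter> {1..N}))"
    using card_image[OF inj] by simp
  then show ?thesis by (simp add: card_cartesian_product power2_eq_square)
qed

text \<open>Swapping coordinates pairs off everything except the diagonal, where
  \<open>(1, 1)\<close> is the only coprime pair.\<close>

lemma card_coprime_pairs_eq:
  assumes "N \<ge> 1"
  shows "card (coprime_pairs D N) = 2 * card {(p, q) \<in> coprime_pairs D N. p < q} + 1"
proof -
  let ?L = "{(p, q) \<in> coprime_pairs D N. p < q}"
  have fin: "finite ?L" by (rule finite_subset[of _ "coprime_pairs D N"]) auto
  have "coprime_pairs D N = insert (1, 1) (?L \<union> prod.swap ` ?L)"
  proof (intro equalityI subsetI)
    fix x assume x: "x \<in> coprime_pairs D N"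
    obtain p q where [simp]: "x = (p, q)" by (cases x)
    show "x \<in> insert (1, 1) (?L \<union> prod.swap ` ?L)"
      using x by (cases p q rule: linorder_cases)
        (auto simp: coprime_pairs_def image_iff coprime_commute)
  qed (use one assms in \<open>auto simp: coprime_pairs_def coprime_commute\<close>)
  also have "card \<dots> = Suc (card ?L + card (prod.swap ` ?L))"
    using fin by (subst card_insert_disjoint) (auto intro!: card_Un_disjoint)
  also have "card (prod.swap ` ?L) = card ?L" by (intro card_image) auto
  finally show ?thesis by simp
qed

end

section \<open>Asymptotics of the gcd identity and the density of coprime pairs\<close>

text \<open>Rounding changes the quotient by at most 1. At \<open>d = 0\<close> both sides are 0 by
  the convention for division by zero.\<close>

lemma tendsto_real_div_nat:
  "(\<lambda>n. real (n div d) / real n) \<longlonglongrightarrow> 1 / real d"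
proof -
  have "(\<lambda>n. real (n div d) / real n - 1 / real d) \<longlonglongrightarrow> 0"
  proof (rule Lim_null_comparison[OF _ lim_inverse_n])
    have "\<bar>real (n div d) / real n - 1 / real d\<bar> \<le> inverse (real n)" if "n > 0" for n
    proof -
      have "\<bar>real (n div d) - real n / real d\<bar> \<le> 1"
      proof (cases "d = 0")
        case False
        then have "real (n mod d) / real d \<le> 1"
          using mod_less_divisor[of d n] by simp
        then show ?thesis using of_nat_of_nat_div_aux[of n d, where ?'a = real] by simp
      qed simp
      moreover have "real (n div d) / real n - 1 / real d = (real (n div d) - real n / real d) / real n"
        using that by (simp add: diff_divide_distrib)
      ultimately show ?thesis using that by (simp add: abs_divide field_simps)
    qed
    then show "eventually (\<lambda>n. norm (real (n div d) / real n - 1 / real d) \<le> inverse (real n)) sequentially"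
      by (intro eventually_sequentiallyI[of 1]) auto
  qed
  then show ?thesis by (simp add: LIM_zero_iff)
qed

text \<open>Each term, divided by \<open>(real n)\<^sup>2\<close>, tends to
  \<open>1 / (real d)\<^sup>2\<close> and is dominated by it, so Tannery's theorem exchanges limit
  and sum.\<close>

lemma tendsto_sum_square_div:
  assumes S: "((\<lambda>d. 1 / (real d)\<^sup>2) has_sum S) D" and D: "0 \<notin> D"
  shows "(\<lambda>n. (\<Sum>d\<in>D \<inter> {1..n}. (real (n div d))\<^sup>2) / (real n)\<^sup>2) \<longlonglongrightarrow> S"
proof -
  define a where "a d n = (if d \<in> D then (real (n div d) / real n)\<^sup>2 else 0)" for d n :: nat
  define b where "b d = (if d \<in> D then 1 / (real d)\<^sup>2 else 0)" for d
  have "(b has_sum S) UNIV"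
    by (rule has_sum_cong_neutral[THEN iffD1, OF _ _ _ S]) (auto simp: b_def)
  then have b: "b sums S" by (rule has_sum_imp_sums)
  have "(\<lambda>n. \<Sum>d. a d n) \<longlonglongrightarrow> suminf b"
  proof (rule tannerys_theorem[THEN conjunct2, THEN conjunct2])
    show "(\<lambda>n. a d n) \<longlonglongrightarrow> b d" for d
      using tendsto_power[OF tendsto_real_div_nat[of d], of 2]
      by (auto simp: a_def b_def power_divide)
    have "norm (a d n) \<le> b d" for d n
    proof (cases "n = 0")
      case False
      then show ?thesis
        using real_div_le_mono_square[of n d]
        by (auto simp: a_def b_def power_divide field_simps)
    qed (auto simp: a_def b_def)
    then show "\<forall>\<^sub>F (d, n) in sequentially \<times>\<^sub>F sequentially. norm (a d n) \<le> b d"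
      by (intro always_eventually) auto
    show "summable b" using b by (rule sums_summable)
  qed simp
  moreover have "(\<Sum>d. a d n) = (\<Sum>d\<in>D \<inter> {1..n}. (real (n div d))\<^sup>2) / (real n)\<^sup>2" for n
  proof -
    \<comment> \<open>The series is really finite, because \<open>n div d = 0\<close> for
      \<open>d > n\<close>.\<close>
    have "(\<Sum>d. a d n) = (\<Sum>d\<in>D \<inter> {1..n}. a d n)"
    proof (rule suminf_finite)
      fix d assume "d \<notin> D \<inter> {1..n}"
      then have "d \<notin> D \<or> n < d" using D by (cases d) auto
      then show "a d n = 0" by (auto simp: a_def)
    qed auto
    then show ?thesis
      by (simp add: a_def power_divide sum_divide_distrib)
  qed
  ultimately show ?thesis using b by (simp add: sums_iff)
qed

theorem (in gcd_closed_monoid) coprime_pairs_density: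
  assumes dens: "(\<lambda>N. real (card (D \<inter> {1..N})) / real N) \<longlonglongrightarrow> \<delta>"
    and S: "((\<lambda>d. 1 / (real d)\<^sup>2) has_sum S) D" and S2: "S < 2"
  shows "(\<lambda>N. real (card (coprime_pairs D N)) / (real N)\<^sup>2) \<longlonglongrightarrow> \<delta>\<^sup>2 / S"
proof -
  \<comment> \<open>The value is forced: summing \<open>l * (real (N div d))\<^sup>2\<close> over
    \<open>D\<close> gives about \<open>l * S * (real N)\<^sup>2\<close>, which has to match
    \<open>\<delta>\<^sup>2 * (real N)\<^sup>2\<close>.\<close>
  define l where "l = \<delta>\<^sup>2 / S"
  define F where "F N = real (card (coprime_pairs D N)) - l * (real N)\<^sup>2" for N
  have split: "(\<Sum>d\<in>D \<inter> {1..N}. f d) = f 1 + (\<Sum>d\<in>D \<inter> {2..N}. f d)"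
    if "N \<ge> 1" for N and f :: "nat \<Rightarrow> real"
  proof -
    have "D \<inter> {1..N} = insert 1 (D \<inter> {2..N})" using one that by auto
    then show ?thesis by simp
  qed
  have fin: "(\<Sum>d\<in>D \<inter> {1..N}. 1 / (real d)\<^sup>2) \<le> S" for N
    using S by (intro finite_sum_le_has_sum[OF S]) auto
  have "S \<ge> 1" using fin[of 1] split[of 1 "\<lambda>d. 1 / (real d)\<^sup>2"] by simp
  \<comment> \<open>\<open>R\<close> is the gcd identity with its main terms subtracted: as a sum of
    \<open>F (N div d)\<close> it gives the recursion, and in the form below its two parts cancel to
    leading order.\<close>
  define R where "R N = (real (card (D \<inter> {1..N})))\<^sup>2
      - l * (\<Sum>d\<in>D \<inter> {1..N}. (real (N div d))\<^sup>2)" for N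
  have R_eq: "R N = (\<Sum>d\<in>D \<inter> {1..N}. F (N div d))" for N
    using arg_cong[OF card_square_eq_sum_coprime_pairs[of N], of real]
    by (simp add: R_def F_def sum_subtractf sum_distrib_left)
  have "(\<lambda>N. (real (card (D \<inter> {1..N})) / real N)\<^sup>2
      - l * ((\<Sum>d\<in>D \<inter> {1..N}. (real (N div d))\<^sup>2) / (real N)\<^sup>2)) \<longlonglongrightarrow> \<delta>\<^sup>2 - l * S"
    by (intro tendsto_intros dens tendsto_sum_square_div S zero)
  then have R: "(\<lambda>N. R N / (real N)\<^sup>2) \<longlonglongrightarrow> 0"
    using \<open>S \<ge> 1\<close> by (simp add: R_def l_def power_divide diff_divide_distrib)
  have "(\<lambda>N. F N / (real N)\<^sup>2) \<longlonglongrightarrow> 0"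
  proof (rule contraction_little_o[where D = D and s = "S - 1" and ?K0.0 = "1 + \<bar>l\<bar>"])
    fix N
    have "card (coprime_pairs D N) \<le> card ({1..N} \<times> {1..N})"
      using coprime_pairs_subset[of D N] by (intro card_mono) (auto simp: Int_atMost)
    then have "real (card (coprime_pairs D N)) \<le> (real N)\<^sup>2"
      by (simp add: power2_eq_square flip: of_nat_mult)
    moreover have "\<bar>l * (real N)\<^sup>2\<bar> = \<bar>l\<bar> * (real N)\<^sup>2" by (simp add: abs_mult)
    ultimately show "\<bar>F N\<bar> \<le> (1 + \<bar>l\<bar>) * (real N)\<^sup>2"
      unfolding F_def ring_distribs by linarith
  next
    fix e :: real assume "e > 0"
    from tendsto_div_square_zeroD[OF R this] obtain C
      where C: "C \<ge> 0" "\<And>N. \<bar>R N\<bar> \<le> e * (real N)\<^sup>2 + C" by blast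
    have "\<bar>F N\<bar> \<le> e * (real N)\<^sup>2 + C + (\<Sum>d\<in>D \<inter> {2..N}. \<bar>F (N div d)\<bar>)" for N
    \<comment> \<open>At \<open>N = 0\<close> the index set has no term \<open>d = 1\<close> to
      isolate, but \<open>F 0 = 0\<close>.\<close>
    proof (cases "N = 0")
      case True
      have "coprime_pairs D 0 = {}" using zero by (auto simp: coprime_pairs_def)
      with True C(1) show ?thesis by (simp add: F_def)
    next
      case False
      then have "R N = F N + (\<Sum>d\<in>D \<inter> {2..N}. F (N div d))"
        using split[of N "\<lambda>d. F (N div d)"] by (simp add: R_eq)
      then show ?thesis
        using C(2)[of N] sum_abs[of "\<lambda>d. F (N div d)" "D \<inter> {2..N}"] by linarith
    qed
    with C(1) show "\<exists>C\<ge>0. \<forall>N. \<bar>F N\<bar> \<le> e * (real N)\<^sup>2 + C + (\<Sum>d\<in>D \<inter> {2..N}. \<bar>F (N div d)\<bar>)"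
      by blast
  next
    fix N
    show "(\<Sum>d\<in>D \<inter> {2..N}. 1 / (real d)\<^sup>2) \<le> S - 1"
    proof (cases "N = 0")
      case False
      then show ?thesis using fin[of N] split[of N "\<lambda>d. 1 / (real d)\<^sup>2"] by simp
    qed (use \<open>S \<ge> 1\<close> in simp)
  qed (use S2 in simp)
  then have "(\<lambda>N. F N / (real N)\<^sup>2 + l) \<longlonglongrightarrow> 0 + l" by (intro tendsto_intros)
  moreover have "eventually (\<lambda>N. F N / (real N)\<^sup>2 + l = real (card (coprime_pairs D N)) / (real N)\<^sup>2) sequentially"
    by (intro eventually_sequentiallyI[of 1]) (auto simp: F_def field_simps)
  ultimately show ?thesis unfolding l_def by (auto elim: Lim_transform_eventually)
qed

lemma (in gcd_closed_monoid) coprime_pairs_less_density: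
  assumes "(\<lambda>N. real (card (coprime_pairs D N)) / (real N)\<^sup>2) \<longlonglongrightarrow> c"
  shows "(\<lambda>N. real (card {(p, q) \<in> coprime_pairs D N. p < q}) / (real N)\<^sup>2) \<longlonglongrightarrow> c / 2"
proof -
  have "(\<lambda>N. (real (card (coprime_pairs D N)) / (real N)\<^sup>2 - (inverse (real N))\<^sup>2) / 2) \<longlonglongrightarrow> (c - 0\<^sup>2) / 2"
    by (intro tendsto_intros assms lim_inverse_n) simp
  moreover have "eventually (\<lambda>N. (real (card (coprime_pairs D N)) / (real N)\<^sup>2 - (inverse (real N))\<^sup>2) / 2
      = real (card {(p, q) \<in> coprime_pairs D N. p < q}) / (real N)\<^sup>2) sequentially"
    by (intro eventually_sequentiallyI[of 1])
       (simp add: card_coprime_pairs_eq power_inverse inverse_eq_divide power_divide case_prod_unfold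
         flip: diff_divide_distrib)
  ultimately show ?thesis by (auto elim: Lim_transform_eventually)
qed

section \<open>Integers of even dyadic order\<close>

text \<open>Positivity is explicit because \<open>multiplicity 2 0 = 0\<close> would otherwise admit
  0.\<close>

definition even_ord2 :: "nat set" where
  "even_ord2 = {n. n > 0 \<and> even (multiplicity 2 n)}"

lemma multiplicity_2_double: "n > 0 \<Longrightarrow> multiplicity 2 (2 * n) = Suc (multiplicity 2 n)"
  for n :: nat
  by (rule multiplicity_times_same) auto

text \<open>Removing one factor 2 from an integer of odd order leaves an even order.\<close>

lemma positive_eq_even_ord2_Un_double: "{1..} = even_ord2 \<union> (*) 2 ` even_ord2"
proof (intro equalityI subsetI)
  fix n :: nat assume n: "n \<in> {1..}"
  show "n \<in> even_ord2 \<union> (*) 2 ` even_ord2"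
  proof (cases "even (multiplicity 2 n)")
    case True
    with n show ?thesis by (auto simp: even_ord2_def)
  next
    case False
    then have "even n" by (metis not_dvd_imp_multiplicity_0 even_zero)
    then obtain m where "n = 2 * m" by blast
    with n False show ?thesis by (auto simp: even_ord2_def multiplicity_2_double)
  qed
qed (auto simp: even_ord2_def)

lemma even_ord2_disjoint_double: "even_ord2 \<inter> (*) 2 ` even_ord2 = {}"
  by (auto simp: even_ord2_def multiplicity_2_double)

interpretation positive: gcd_closed_monoid "{1..}"
  by unfold_locales (auto simp: Suc_le_eq)

text \<open>The order at 2 is additive on products, and on a gcd it is the smaller of two even
  numbers.\<close>

interpretation even_ord2: gcd_closed_monoid even_ord2
proof
  fix a b :: nat
  show "a * b \<in> even_ord2" if "a \<in> even_ord2" "b \<in> even_ord2"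
    using that by (auto simp: even_ord2_def prime_elem_multiplicity_mult_distrib)
  show "b \<in> even_ord2" if "a * b \<in> even_ord2" "a \<in> even_ord2"
    using that by (auto simp: even_ord2_def prime_elem_multiplicity_mult_distrib)
  show "gcd a b \<in> even_ord2" if "a \<in> even_ord2" "b \<in> even_ord2"
    using that by (auto simp: even_ord2_def multiplicity_gcd min_def)
qed (auto simp: even_ord2_def)

lemma card_even_ord2_add: "card (even_ord2 \<inter> {1..N}) + card (even_ord2 \<inter> {1..N div 2}) = N"
proof -
  have "{1..N} = (even_ord2 \<inter> {1..N}) \<union> (*) 2 ` (even_ord2 \<inter> {1..N div 2})"
  proof -
    have "{1..N} = {1..} \<inter> {1..N}" by auto
    also have "\<dots> = (even_ord2 \<inter> {1..N}) \<union> (*) 2 ` (even_ord2 \<inter> {1..N div 2})"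
      unfolding positive_eq_even_ord2_Un_double using even_ord2.pos by fastforce
    finally show ?thesis .
  qed
  then have "card {1..N} = card ((even_ord2 \<inter> {1..N}) \<union> (*) 2 ` (even_ord2 \<inter> {1..N div 2}))"
    by (rule arg_cong)
  also have "\<dots> = card (even_ord2 \<inter> {1..N}) + card ((*) 2 ` (even_ord2 \<inter> {1..N div 2}))"
    by (rule card_Un_disjoint) (use even_ord2_disjoint_double in blast)+
  also have "card ((*) 2 ` (even_ord2 \<inter> {1..N div 2})) = card (even_ord2 \<inter> {1..N div 2})"
    by (intro card_image inj_onI) auto
  finally show ?thesis by simp
qed

text \<open>With \<open>A(N)\<close> the counting function, \<open>A(N) + A(N div 2) = N\<close>
  suggests \<open>A(N)\<close> is about \<open>2 / 3 * N\<close>. The error \<open>h\<close> grows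
  by at most \<open>1 / 3\<close> per halving, and finitely many halvings push its linear part below
  any \<open>e * N\<close>.\<close>

lemma even_ord2_density: "(\<lambda>N. real (card (even_ord2 \<inter> {1..N})) / real N) \<longlonglongrightarrow> 2 / 3"
proof -
  define h where "h N = real (card (even_ord2 \<inter> {1..N})) - 2 / 3 * real N" for N
  \<comment> \<open>In fact \<open>h N + h (N div 2) = real (N mod 2) / 3\<close>.\<close>
  have rec: "\<bar>h N\<bar> \<le> \<bar>h (N div 2)\<bar> + 1 / 3" for N
  proof -
    have "real N = 2 * real (N div 2) + real (N mod 2)"
      by (metis mult_div_mod_eq of_nat_add of_nat_mult of_nat_numeral)
    moreover have "real (N mod 2) \<le> 1" "real (N mod 2) \<ge> 0" by simp_all
    moreover have "real (card (even_ord2 \<inter> {1..N})) + real (card (even_ord2 \<inter> {1..N div 2})) = real N"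
      using card_even_ord2_add[of N] by linarith
    ultimately show ?thesis unfolding h_def by linarith
  qed
  have bound: "\<bar>h N\<bar> \<le> real N / 2 ^ k + real k" for k N
  proof (induction k arbitrary: N)
    case 0
    have "card (even_ord2 \<inter> {1..N}) \<le> N" using card_even_ord2_add[of N] by linarith
    then show ?case by (simp add: h_def)
  next
    case (Suc k)
    have "\<bar>h N\<bar> \<le> real (N div 2) / 2 ^ k + real k + 1 / 3"
      using rec[of N] Suc[of "N div 2"] by linarith
    also have "real (N div 2) / 2 ^ k \<le> real N / 2 / 2 ^ k"
      using of_nat_div_le_of_nat[of N 2] by (intro divide_right_mono) auto
    also have "real N / 2 / 2 ^ k = real N / 2 ^ Suc k" by simp
    finally show ?case by simp
  qed
  have "(\<lambda>N. h N / real N ^ 1) \<longlonglongrightarrow> 0"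
  proof (rule tendsto_div_power_zeroI)
    fix e :: real assume "e > 0"
    then obtain k where k: "(1 / 2) ^ k < e" using real_arch_pow_inv[of e "1 / 2"] by auto
    have "\<bar>h N\<bar> \<le> e * real N ^ 1 + real k" for N
    proof -
      have "real N / 2 ^ k \<le> e * real N"
        using mult_right_mono[of "(1 / 2) ^ k" e "real N"] k by (simp add: power_one_over)
      then show ?thesis using bound[of N k] by simp
    qed
    then show "\<exists>C. \<forall>N. \<bar>h N\<bar> \<le> e * real N ^ 1 + C" by blast
  qed simp
  then have "(\<lambda>N. h N / real N + 2 / 3) \<longlonglongrightarrow> 0 + 2 / 3" by (intro tendsto_intros) simp
  moreover have "eventually (\<lambda>N. h N / real N + 2 / 3 = real (card (even_ord2 \<inter> {1..N})) / real N) sequentially"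
    by (intro eventually_sequentiallyI[of 1]) (auto simp: h_def field_simps)
  ultimately show ?thesis by (auto elim: Lim_transform_eventually)
qed

section \<open>Sums of inverse squares\<close>

lemma has_sum_inverse_squares: "((\<lambda>n. 1 / (real n)\<^sup>2) has_sum (pi\<^sup>2 / 6)) {1..}"
proof -
  have "((\<lambda>n. 1 / (real (Suc n))\<^sup>2) has_sum (pi\<^sup>2 / 6)) UNIV"
    using inverse_squares_sums by (intro sums_nonneg_imp_has_sum) (auto simp: add.commute)
  moreover have "bij_betw Suc UNIV {1..}"
    by (rule bij_betwI[of _ _ _ "\<lambda>n. n - 1"]) auto
  ultimately show ?thesis
    using has_sum_reindex_bij_betw[of Suc UNIV "{1..}" "\<lambda>n. 1 / (real n)\<^sup>2"] by simp
qed

text \<open>The doubles contribute a quarter of the sum \<open>S\<close> over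
  \<open>even_ord2\<close>, so \<open>S + S / 4\<close> is the full sum
  \<open>pi\<^sup>2 / 6\<close>.\<close>

lemma has_sum_inverse_squares_even_ord2:
  "((\<lambda>n. 1 / (real n)\<^sup>2) has_sum (2 * pi\<^sup>2 / 15)) even_ord2"
proof -
  let ?f = "\<lambda>n. 1 / (real n)\<^sup>2"
  have "?f summable_on even_ord2"
    using has_sum_imp_summable[OF has_sum_inverse_squares]
    by (rule summable_on_subset_banach) (auto simp: even_ord2_def)
  then obtain S where S: "(?f has_sum S) even_ord2" by (auto simp: summable_on_def)
  have "((\<lambda>n. 1 / 4 * ?f n) has_sum (1 / 4 * S)) even_ord2"
    by (intro has_sum_cmult_right S)
  then have "(?f has_sum (1 / 4 * S)) ((*) 2 ` even_ord2)"
    by (subst has_sum_reindex) (auto simp: o_def power_mult_distrib inj_on_def)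
  then have "(?f has_sum (S + 1 / 4 * S)) {1..}"
    unfolding positive_eq_even_ord2_Un_double
    by (intro has_sum_Un_disjoint S even_ord2_disjoint_double)
  then have "S + 1 / 4 * S = pi\<^sup>2 / 6"
    using has_sum_inverse_squares by (rule has_sum_unique)
  then have "S = 2 * pi\<^sup>2 / 15" by simp
  with S show ?thesis by simp
qed

text \<open>This is the contraction condition \<open>S < 2\<close> for
  \<open>S = pi\<^sup>2 / 6\<close>; it also covers the smaller sum
  \<open>2 * pi\<^sup>2 / 15\<close>.\<close>

lemma pi_squared_less_12: "pi\<^sup>2 < 12"
proof -
  have "pi\<^sup>2 \<le> (3.2)\<^sup>2" using pi_approx by (intro power_mono) auto
  then show ?thesis by (simp add: power2_eq_square)
qed

section \<open>Densities of \<open>W\<close> and \<open>W_hat\<close>\<close>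

theorem theorem1p13:
  shows "((\<lambda>N::nat. real (card (W \<inter> ({1..N} \<times> {1..N}))) / (real N)\<^sup>2)
            \<longlonglongrightarrow> 5 / (3 * pi\<^sup>2)) \<and>
         ((\<lambda>N::nat. real (card (W_hat \<inter> ({1..N} \<times> {1..N}))) / (real N)\<^sup>2)
            \<longlonglongrightarrow> 4 / (3 * pi\<^sup>2))"
proof -
  define w where "w N = {(p, q) \<in> coprime_pairs even_ord2 N. p < q}" for N
  define t where "t N = {(p, q) \<in> coprime_pairs {1..} N. p < q}" for N
  have fin: "finite (w N)" "finite (t N)" for N
    by (rule finite_subset[of _ "coprime_pairs even_ord2 N"]; auto simp: w_def)
       (rule finite_subset[of _ "coprime_pairs {1..} N"]; auto simp: t_def)
  have W: "W \<inter> ({1..N} \<times> {1..N}) = w N" for N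
    by (auto simp: W_def w_def coprime_pairs_def even_ord2_def Suc_le_eq)
  have sub: "w N \<subseteq> t N" for N
    by (auto simp: w_def t_def coprime_pairs_def even_ord2_def Suc_le_eq)
  \<comment> \<open>\<open>W_hat\<close> is the complement of \<open>W\<close> among all coprime
    pairs with \<open>p < q\<close>, so its density is \<open>3 / pi\<^sup>2\<close> minus that of
    \<open>W\<close>.\<close>
  have "W_hat \<inter> ({1..N} \<times> {1..N}) = t N - w N" for N
    by (auto simp: W_hat_def w_def t_def coprime_pairs_def even_ord2_def Suc_le_eq)
  then have W_hat: "real (card (W_hat \<inter> ({1..N} \<times> {1..N}))) = real (card (t N)) - real (card (w N))" for N
    using sub[of N] fin by (simp add: card_Diff_subset card_mono of_nat_diff)
  have "(\<lambda>N. real (card (w N)) / (real N)\<^sup>2) \<longlonglongrightarrow> ((2 / 3)\<^sup>2 / (2 * pi\<^sup>2 / 15)) / 2"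
    unfolding w_def using pi_squared_less_12
    by (intro even_ord2.coprime_pairs_less_density even_ord2.coprime_pairs_density
          even_ord2_density has_sum_inverse_squares_even_ord2) simp
  then have w: "(\<lambda>N. real (card (w N)) / (real N)\<^sup>2) \<longlonglongrightarrow> 5 / (3 * pi\<^sup>2)"
    by (simp add: power2_eq_square)
  have "(\<lambda>N. real (card ({1..} \<inter> {1..N})) / real N) \<longlonglongrightarrow> 1"
    by (rule tendsto_eventually, intro eventually_sequentiallyI[of 1]) (simp add: Int_absorb1)
  then have "(\<lambda>N. real (card (t N)) / (real N)\<^sup>2) \<longlonglongrightarrow> (1\<^sup>2 / (pi\<^sup>2 / 6)) / 2"
    unfolding t_def using pi_squared_less_12
    by (intro positive.coprime_pairs_less_density positive.coprime_pairs_density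
          has_sum_inverse_squares) simp_all
  then have "(\<lambda>N. real (card (t N)) / (real N)\<^sup>2) \<longlonglongrightarrow> 3 / pi\<^sup>2" by simp
  from tendsto_diff[OF this w]
  have "(\<lambda>N. real (card (W_hat \<inter> ({1..N} \<times> {1..N}))) / (real N)\<^sup>2) \<longlonglongrightarrow> 3 / pi\<^sup>2 - 5 / (3 * pi\<^sup>2)"
    unfolding W_hat diff_divide_distrib .
  also have "3 / pi\<^sup>2 - 5 / (3 * pi\<^sup>2) = 4 / (3 * pi\<^sup>2)" by (simp add: field_simps)
  finally show ?thesis using w unfolding W by blast
qed

end
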